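(* Minimum representation fairness (MR-fairness) is incompatible with social fairness. That is, there exist a fair clustering instance $(\mathcal X,\mathcal G)$ with a number of clusters $K$ and an MR-fairness parameter $(\alpha,\boldsymbol\beta)$ such that, for every non-trivial social fairness parameter $\alpha_{SF}\ge1$, no clustering of $\mathcal X$ into $K$ clusters is both $(\alpha,\boldsymbol\beta)$-minimum representation fair and (with some choice of admissible centers) socially fair with parameter $\alpha_{SF}$.
   Context: A fair clustering instance consists of $n$ indexed data points $\mathcal X=\{x^1,\dots,x^n\}\subset\mathbb R^m$ (distinct indices may carry the same location) and groups: there is a finite set $\mathcal F$ of sensitive features, each $f\in\mathcal F$ has a finite set of values $\mathcal G_f$, $\mathcal G=\bigcup_f\mathcal G_f$ is the set of groups, $X_g\subseteq\mathcal X$ is the set of points in group $g$, and $\{X_g\}_{g\in\mathcal G_f}$ partitions $\mathcal X$ for each $f$. A clustering is a partition $\mathcal C=\{C_1,\dots,C_K\}$ of $\mathcal X$ into $K$ nonempty clusters; $\mathcal K=\{1,\dots,K\}$. Each cluster $C_k$ has a center $c_k$, and $D(x,c)$ is the assignment cost: in the $k$-means setting $D(x,c)=\|x-c\|_2^2$ and $c_k\in\mathbb R^m$ is arbitrary; in the $k$-medians setting $D$ is any distance function and $c_k\in C_k$. The claim is for either setting. MR-fairness: for $\alpha\in(0,1]$, group $g$ is $\alpha$-represented in $C_k$ if $|C_k\cap X_g|\ge\alpha|C_k|$; $\Lambda(\mathcal C,X_g,\alpha)$ is the number of clusters in which $g$ is $\alpha$-represented. For $\boldsymbol\beta=(\beta_g)_{g\in\mathcal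 G}$ with $\beta_g\in\mathbb Z^+$, $\mathcal C$ is $(\alpha,\boldsymbol\beta)$-minimum representation fair if $\Lambda(\mathcal C,X_g,\alpha)\ge\beta_g$ for every $g\in\mathcal G$. Social fairness with parameter $\alpha_{SF}\ge1$: a clustering $\bar{\mathcal C}$ with centers $\bar c$ is socially fair if $$\max_{g\in\mathcal G}\frac1{|X_g|}\sum_{k\in\mathcal K}\sum_{x^i\in X_g\cap\bar C_k}D(x^i,\bar c_k)\le\alpha_{SF}\min_{\mathcal C,c_1,\dots,c_K}\max_{g\in\mathcal G}\frac1{|X_g|}\sum_{k\in\mathcal K}\sum_{x^i\in X_g\cap C_k}D(x^i,c_k).$$ Incompatibility: for a parametrized fairness criterion $f_{\mathbf p}$, let $\Psi(\mathcal X,\mathcal G,f_{\mathbf p})$ be the set of clusterings satisfying it. A criterion $f$ is incompatible with a criterion $g$ if there exist an instance $\mathcal X,\mathcal G$ and a parameter $\mathbf p_1$ for $f$ with $\Psi(\mathcal X,\mathcal G,f_{\mathbf p_1})\cap\Psi(\mathcal X,\mathcal G,g_{\mathbf p_2})=\emptyset$ for all non-trivial $\mathbf p_2$, where a parameter is non-trivial if it is not satisfied by all clusterings of the dataset. *)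

theory Defs
  imports "HOL-Analysis.Analysis" "HOL-Library.Disjoint_Sets"
begin

text \<open>Data points are represented by their indices, so that several of them may share a location;
  groups and clusters are sets of indices. Features and groups carry natural-number names.\<close>

record 'a fair_data =
  num_points :: nat
  location :: "nat \<Rightarrow> 'a"
  features :: "nat set"
  feature_values :: "nat \<Rightarrow> nat set"
  members :: "nat \<Rightarrow> nat set"

definition points :: "'a fair_data \<Rightarrow> nat set" where
  "points I = {1..num_points I}"

definition groups :: "'a fair_data \<Rightarrow> nat set" where
  "groups I = (\<Union>f\<in>features I. feature_values I f)"

text \<open>Injectivity turns the condition on the set of parts into one on the indexed family
  of groups. The parts of a partition are nonempty, so \<open>1 / |X\<^sub>g|\<close> is meaningful.\<close>

definition valid_data :: "'a fair_data \<Rightarrow> bool" where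
  "valid_data I \<longleftrightarrow>
     1 \<le> num_points I \<and> finite (features I) \<and> features I \<noteq> {} \<and>
     (\<forall>f\<in>features I. finite (feature_values I f) \<and>
        inj_on (members I) (feature_values I f) \<and>
        partition_on (points I) (members I ` feature_values I f))"

definition clusterings :: "'a fair_data \<Rightarrow> nat \<Rightarrow> nat set set set" where
  "clusterings I K = {\<C>. partition_on (points I) \<C> \<and> card \<C> = K}"


definition represented :: "'a fair_data \<Rightarrow> real \<Rightarrow> nat \<Rightarrow> nat set \<Rightarrow> bool" where
  "represented I \<alpha> g C \<longleftrightarrow> real (card (C \<inter> members I g)) \<ge> \<alpha> * real (card C)"

definition num_represented :: "'a fair_data \<Rightarrow> nat set set \<Rightarrow> nat \<Rightarrow> real \<Rightarrow> nat" where
  "num_represented I \<C> g \<alpha> = card {C \<in> \<C>. represented I \<alpha> g C}"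

definition mr_params :: "'a fair_data \<Rightarrow> (real \<times> (nat \<Rightarrow> nat)) set" where
  "mr_params I = {(\<alpha>, \<beta>). 0 < \<alpha> \<and> \<alpha> \<le> 1 \<and> (\<forall>g\<in>groups I. 1 \<le> \<beta> g)}"

text \<open>The number of clusters is an argument only for uniformity with other criteria.\<close>

definition mr_fair ::
    "'a fair_data \<Rightarrow> nat \<Rightarrow> real \<times> (nat \<Rightarrow> nat) \<Rightarrow> nat set set \<Rightarrow> bool" where
  "mr_fair I K p \<C> \<longleftrightarrow> (case p of (\<alpha>, \<beta>) \<Rightarrow>
     \<forall>g\<in>groups I. num_represented I \<C> g \<alpha> \<ge> \<beta> g)"


text \<open>A center assignment maps each cluster to its center; only its values on the clusters of the
  clustering at hand matter. \<open>A I C\<close> is the set of admissible centers of the cluster \<open>C\<close>.\<close>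

type_synonym 'a center_rule = "'a fair_data \<Rightarrow> nat set \<Rightarrow> 'a set"

definition social_cost ::
    "('a \<Rightarrow> 'a \<Rightarrow> real) \<Rightarrow> 'a fair_data \<Rightarrow> nat set set \<Rightarrow> (nat set \<Rightarrow> 'a) \<Rightarrow> real" where
  "social_cost D I \<C> c =
     Max ((\<lambda>g. 1 / real (card (members I g)) *
             (\<Sum>C\<in>\<C>. \<Sum>i\<in>members I g \<inter> C. D (location I i) (c C))) ` groups I)"

text \<open>The infimum is attained for the \<open>k\<close>-means and \<open>k\<close>-medians choices of \<open>D\<close> and \<open>A\<close> below
  on valid data with \<open>1 \<le> K \<le> n\<close>, hence it is the minimum.\<close>

definition optimal_social_cost ::
    "('a \<Rightarrow> 'a \<Rightarrow> real) \<Rightarrow> 'a center_rule \<Rightarrow> 'a fair_data \<Rightarrow> nat \<Rightarrow> real" where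
  "optimal_social_cost D A I K =
     Inf {social_cost D I \<C> c | \<C> c. \<C> \<in> clusterings I K \<and> (\<forall>C\<in>\<C>. c C \<in> A I C)}"

definition sf_params :: "'a fair_data \<Rightarrow> real set" where
  "sf_params I = {\<alpha>. 1 \<le> \<alpha>}"

definition socially_fair ::
    "('a \<Rightarrow> 'a \<Rightarrow> real) \<Rightarrow> 'a center_rule \<Rightarrow> 'a fair_data \<Rightarrow> nat \<Rightarrow> real \<Rightarrow> nat set set \<Rightarrow> bool" where
  "socially_fair D A I K \<alpha> \<C> \<longleftrightarrow>
     (\<exists>c. (\<forall>C\<in>\<C>. c C \<in> A I C) \<and> social_cost D I \<C> c \<le> \<alpha> * optimal_social_cost D A I K)"

definition kmeans_cost :: "real ^ 'm \<Rightarrow> real ^ 'm \<Rightarrow> real" where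
  "kmeans_cost x c = (norm (x - c))\<^sup>2"

definition kmeans_centers :: "'a center_rule" where
  "kmeans_centers I C = UNIV"

definition kmedians_centers :: "'a center_rule" where
  "kmedians_centers I C = location I ` C"


type_synonym ('a, 'p) criterion = "'a fair_data \<Rightarrow> nat \<Rightarrow> 'p \<Rightarrow> nat set set \<Rightarrow> bool"

definition fair_clusterings ::
    "('a, 'p) criterion \<Rightarrow> 'a fair_data \<Rightarrow> nat \<Rightarrow> 'p \<Rightarrow> nat set set set" where
  "fair_clusterings f I K p = {\<C> \<in> clusterings I K. f I K p \<C>}"

definition nontrivial :: "('a, 'p) criterion \<Rightarrow> 'a fair_data \<Rightarrow> nat \<Rightarrow> 'p \<Rightarrow> bool" where
  "nontrivial f I K p \<longleftrightarrow> \<not> (\<forall>\<C>\<in>clusterings I K. f I K p \<C>)"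

text \<open>\<open>P\<close> and \<open>Q\<close> are the parameter ranges of the criteria \<open>f\<close> and \<open>g\<close>; they may depend on the
  data. The bounds on \<open>K\<close> say exactly that clusterings into \<open>K\<close> clusters exist.\<close>

definition incompatible ::
    "('a fair_data \<Rightarrow> 'p set) \<Rightarrow> ('a, 'p) criterion \<Rightarrow>
     ('a fair_data \<Rightarrow> 'q set) \<Rightarrow> ('a, 'q) criterion \<Rightarrow> bool" where
  "incompatible P f Q g \<longleftrightarrow>
     (\<exists>I K. valid_data I \<and> 1 \<le> K \<and> K \<le> num_points I \<and>
        (\<exists>p\<in>P I. \<forall>q\<in>Q I. nontrivial g I K q \<longrightarrow>
           fair_clusterings f I K p \<inter> fair_clusterings g I K q = {}))"

end

theory Submission
  imports Defs
begin

text \<open>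
  Place the two members of one group at a location \<open>a\<close>, the two members of another at a
  different location \<open>b\<close>, and ask for two clusters. Clustering by location costs nothing, so the
  optimal social cost is zero. A multiple of zero is zero; hence, whatever its parameter, social
  fairness demands that the cost vanish (\<open>socially_fair_imp_at_center\<close>), which forces each
  cluster to sit at a single location and so to contain a single group. Minimum representation
  fairness with \<open>\<beta> = 2\<close> for both groups demands the opposite: each group must be represented in
  as many clusters as there are, hence must meet every cluster (\<open>mr_fair_imp_meets_all\<close>).

  The conflict is genuine, as each of the two criteria can be met: pairing points of different
  groups gives a clustering in which both groups are \<open>1/2\<close>-represented in both clusters.

  The argument rests on two facts shared by the \<open>k\<close>-means and the \<open>k\<close>-medians setting: the
  assignment cost is nonnegative and vanishes exactly on the diagonal, and every point of a
  cluster is an admissible center of it. So \<open>mr_fair_incompatible_socially_fair\<close> treats both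
  settings at once, on the same data.\<close>

lemma finite_groups: "valid_data I \<Longrightarrow> finite (groups I)"
  by (auto simp: valid_data_def groups_def)

lemma groups_nonempty:
  assumes "valid_data I"
  shows "groups I \<noteq> {}"
proof -
  obtain f where f: "f \<in> features I" using assms by (auto simp: valid_data_def)
  have "partition_on (points I) (members I ` feature_values I f)" "points I \<noteq> {}"
    using assms f by (auto simp: valid_data_def points_def)
  then have "feature_values I f \<noteq> {}"
    by (auto simp: partition_on_def)
  then show ?thesis using f by (auto simp: groups_def)
qed

lemma members_group:
  assumes "valid_data I" "g \<in> groups I"
  shows "finite (members I g)" "members I g \<noteq> {}" "members I g \<subseteq> points I"
proof -
  obtain f where "f \<in> features I" "g \<in> feature_values I f"
    using assms by (auto simp: groups_def)
  then have p: "partition_on (points I) (members I ` feature_values I f)"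
    and g: "members I g \<in> members I ` feature_values I f"
    using assms by (auto simp: valid_data_def)
  show sub: "members I g \<subseteq> points I"
    using p g by (auto simp: partition_on_def)
  then show "finite (members I g)"
    by (rule finite_subset) (simp add: points_def)
  show "members I g \<noteq> {}"
    using p g by (metis partition_onD3)
qed

lemma finite_clustering: "\<C> \<in> clusterings I K \<Longrightarrow> finite \<C>"
  using finite_elements[of "points I" \<C>] by (auto simp: clusterings_def points_def)

lemma group_cost_le_social_cost:
  assumes "valid_data I" "g \<in> groups I"
  shows "1 / real (card (members I g)) *
           (\<Sum>C\<in>\<C>. \<Sum>i\<in>members I g \<inter> C. D (location I i) (c C)) \<le> social_cost D I \<C> c"
  unfolding social_cost_def using assms by (auto intro!: Max_ge simp: finite_groups)

lemma social_cost_nonneg: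
  assumes "valid_data I" "\<And>x y. 0 \<le> D x y"
  shows "0 \<le> social_cost D I \<C> c"
proof -
  obtain g where g: "g \<in> groups I" using groups_nonempty[OF assms(1)] by blast
  have "0 \<le> 1 / real (card (members I g)) *
           (\<Sum>C\<in>\<C>. \<Sum>i\<in>members I g \<inter> C. D (location I i) (c C))"
    using assms(2) by (intro mult_nonneg_nonneg sum_nonneg) auto
  also have "\<dots> \<le> social_cost D I \<C> c"
    by (rule group_cost_le_social_cost[OF assms(1) g])
  finally show ?thesis .
qed

lemma social_cost_at_centers:
  assumes "valid_data I" "\<And>x. D x x = 0"
    and "\<And>C i. C \<in> \<C> \<Longrightarrow> i \<in> C \<Longrightarrow> location I i = c C"
  shows "social_cost D I \<C> c = 0"
proof -
  have "(\<Sum>C\<in>\<C>. \<Sum>i\<in>members I g \<inter> C. D (location I i) (c C)) = 0" for g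
    using assms(2,3) by (auto intro!: sum.neutral)
  then have "(\<lambda>g. 1 / real (card (members I g)) *
      (\<Sum>C\<in>\<C>. \<Sum>i\<in>members I g \<inter> C. D (location I i) (c C))) ` groups I = {0}"
    using groups_nonempty[OF assms(1)] by auto
  then show ?thesis by (simp add: social_cost_def)
qed

lemma social_cost_nonpos_imp_at_center:
  assumes I: "valid_data I" and \<C>: "\<C> \<in> clusterings I K"
    and nonneg: "\<And>x y. 0 \<le> D x y" and zero: "\<And>x y. D x y = 0 \<Longrightarrow> x = y"
    and cost: "social_cost D I \<C> c \<le> 0"
    and i: "g \<in> groups I" "C \<in> \<C>" "i \<in> members I g" "i \<in> C"
  shows "location I i = c C"
proof -
  let ?s = "\<Sum>C\<in>\<C>. \<Sum>i\<in>members I g \<inter> C. D (location I i) (c C)"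
  have fin: "finite (members I g)" and ne: "members I g \<noteq> {}"
    using members_group[OF I i(1)] by auto
  have "1 / real (card (members I g)) * ?s \<le> 0"
    using group_cost_le_social_cost[OF I i(1)] cost by (rule order_trans)
  moreover have "0 < 1 / real (card (members I g))"
    using fin ne by (simp add: card_gt_0_iff)
  ultimately have "?s \<le> 0"
    by (metis mult_le_0_iff not_le)
  moreover have inner: "0 \<le> (\<Sum>i\<in>members I g \<inter> C. D (location I i) (c C))" for C
    using nonneg by (simp add: sum_nonneg)
  ultimately have "?s = 0"
    by (meson order_antisym sum_nonneg)
  then have "(\<Sum>i\<in>members I g \<inter> C. D (location I i) (c C)) = 0"
    using inner i(2) finite_clustering[OF \<C>] by (simp add: sum_nonneg_eq_0_iff)
  then have "D (location I i) (c C) = 0"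
    using nonneg fin i(3,4) by (simp add: sum_nonneg_eq_0_iff)
  then show ?thesis by (rule zero)
qed

lemma optimal_social_cost_nonpos:
  assumes I: "valid_data I" and nonneg: "\<And>x y. 0 \<le> D x y" and "\<And>x. D x x = 0"
    and "\<P> \<in> clusterings I K" "\<forall>C\<in>\<P>. p C \<in> A I C"
    and "\<And>C i. C \<in> \<P> \<Longrightarrow> i \<in> C \<Longrightarrow> location I i = p C"
  shows "optimal_social_cost D A I K \<le> 0"
  unfolding optimal_social_cost_def
proof (rule cInf_lower)
  have "social_cost D I \<P> p = 0"
    using assms by (intro social_cost_at_centers) auto
  then show "0 \<in> {social_cost D I \<C> c | \<C> c. \<C> \<in> clusterings I K \<and> (\<forall>C\<in>\<C>. c C \<in> A I C)}"
    using assms(4,5) by (intro CollectI exI[of _ \<P>] exI[of _ p]) simp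
  (* The infimum of an unbounded set of reals would be an arbitrary value. *)
  show "bdd_below {social_cost D I \<C> c | \<C> c. \<C> \<in> clusterings I K \<and> (\<forall>C\<in>\<C>. c C \<in> A I C)}"
    by (rule bdd_belowI[of _ 0]) (auto intro: social_cost_nonneg[OF I nonneg])
qed

text \<open>A clustering \<open>\<P>\<close> without cost makes social fairness as strict as possible: no parameter
  can relax an optimum of zero. A single center per cluster then means a single location.\<close>

lemma socially_fair_imp_at_center:
  assumes I: "valid_data I"
    and D: "\<And>x y. 0 \<le> D x y" "\<And>x y. D x y = 0 \<longleftrightarrow> x = y"
    and \<P>: "\<P> \<in> clusterings I K" "\<forall>C\<in>\<P>. p C \<in> A I C"
      "\<And>C i. C \<in> \<P> \<Longrightarrow> i \<in> C \<Longrightarrow> location I i = p C"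
    and \<C>: "\<C> \<in> clusterings I K"
    and \<alpha>: "\<alpha> \<in> sf_params I" and sf: "socially_fair D A I K \<alpha> \<C>"
  obtains c where
    "\<And>g C i. g \<in> groups I \<Longrightarrow> C \<in> \<C> \<Longrightarrow> i \<in> members I g \<Longrightarrow> i \<in> C \<Longrightarrow> location I i = c C"
proof -
  obtain c where c: "social_cost D I \<C> c \<le> \<alpha> * optimal_social_cost D A I K"
    using sf by (auto simp: socially_fair_def)
  have "optimal_social_cost D A I K \<le> 0"
    using optimal_social_cost_nonpos[where D = D and A = A, OF I] D \<P> by blast
  then have "\<alpha> * optimal_social_cost D A I K \<le> 0"
    using \<alpha> by (simp add: sf_params_def mult_nonneg_nonpos)
  with c have "social_cost D I \<C> c \<le> 0" by simp
  then show thesis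
    using social_cost_nonpos_imp_at_center[of I \<C> K D, OF I \<C> D(1) D(2)[THEN iffD1]]
    by (intro that) simp
qed

text \<open>Being represented in at least \<open>K\<close> of \<open>K\<close> clusters is being represented in all of them, and
  a positive share of a nonempty cluster is at least one point.\<close>

lemma mr_fair_imp_meets_all:
  assumes \<C>: "\<C> \<in> clusterings I K" and p: "(\<alpha>, \<beta>) \<in> mr_params I"
    and fair: "mr_fair I K (\<alpha>, \<beta>) \<C>"
    and g: "g \<in> groups I" "K \<le> \<beta> g" and C: "C \<in> \<C>"
  shows "C \<inter> members I g \<noteq> {}"
proof -
  have part: "partition_on (points I) \<C>" and card: "card \<C> = K"
    using \<C> by (auto simp: clusterings_def)
  have "card \<C> \<le> card {C \<in> \<C>. represented I \<alpha> g C}"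
    using fair g card by (force simp: mr_fair_def num_represented_def)
  then have "{C \<in> \<C>. represented I \<alpha> g C} = \<C>"
    using finite_clustering[OF \<C>] by (intro card_seteq) auto
  with C have "\<alpha> * real (card C) \<le> real (card (C \<inter> members I g))"
    by (auto simp: represented_def)
  moreover have "0 < \<alpha> * real (card C)"
  proof -
    have "C \<subseteq> points I" "C \<noteq> {}"
      using part C by (auto simp: partition_on_def)
    then have "0 < card C"
      by (auto simp: card_gt_0_iff points_def intro: finite_subset)
    then show ?thesis using p by (simp add: mr_params_def)
  qed
  ultimately have "0 < card (C \<inter> members I g)" by linarith
  then show ?thesis by auto
qed

definition two_site_data :: "'a \<Rightarrow> 'a \<Rightarrow> 'a fair_data" where
  "two_site_data a b =
     \<lparr>num_points = 4, location = (\<lambda>i. if i \<le> 2 then a else b), features = {0},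
      feature_values = (\<lambda>_. {0, 1}), members = (\<lambda>g. if g = 0 then {1, 2} else {3, 4})\<rparr>"

lemma groups_two_site_data: "groups (two_site_data a b) = {0, 1}"
  by (simp add: groups_def two_site_data_def)

lemma partition_points_two_site_data:
  "partition_on (points (two_site_data a b)) {{1, 2}, {3, 4}}"
proof -
  have "points (two_site_data a b) = {1, 2, 3, 4}"
    by (auto simp: points_def two_site_data_def)
  then show ?thesis by (auto simp: partition_on_def disjoint_def)
qed

lemma valid_two_site_data: "valid_data (two_site_data a b)"
proof -
  let ?I = "two_site_data a b"
  have parts: "members ?I ` {0, 1} = {{1, 2}, {3, 4}}"
    by (auto simp: two_site_data_def)
  have "{1, 2} \<noteq> {3, 4 :: nat}" by auto
  then have "inj_on (members ?I) {0, 1}"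
    by (simp add: two_site_data_def)
  moreover have "partition_on (points ?I) (members ?I ` {0, 1})"
    unfolding parts by (rule partition_points_two_site_data)
  moreover have "num_points ?I = 4" "features ?I = {0}" "feature_values ?I f = {0, 1}" for f
    by (simp_all add: two_site_data_def)
  ultimately show ?thesis
    by (simp only: valid_data_def) simp
qed

lemma clustering_by_site: "{{1, 2}, {3, 4}} \<in> clusterings (two_site_data a b) 2"
proof -
  have "{1, 2} \<noteq> {3, 4 :: nat}" by auto
  then show ?thesis
    using partition_points_two_site_data by (simp add: clusterings_def)
qed

lemma mr_fair_incompatible_socially_fair:
  fixes D :: "'a \<Rightarrow> 'a \<Rightarrow> real"
  assumes D: "\<And>x y. 0 \<le> D x y" "\<And>x y. D x y = 0 \<longleftrightarrow> x = y"
    and A: "\<And>I C. location I ` C \<subseteq> A I C"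
    and ab: "a \<noteq> (b :: 'a)"
  shows "incompatible mr_params mr_fair sf_params (socially_fair D A)"
proof -
  define I where "I = two_site_data a b"
  define p where "p = (1 / 2 :: real, \<lambda>_ :: nat. 2 :: nat)"
  have valid: "valid_data I" by (simp add: I_def valid_two_site_data)
  have p: "p \<in> mr_params I" by (simp add: p_def mr_params_def)
  have g: "0 \<in> groups I" "1 \<in> groups I" by (simp_all add: I_def groups_two_site_data)
  have False if q: "q \<in> sf_params I" and \<C>: "\<C> \<in> clusterings I 2"
    and mr: "mr_fair I 2 p \<C>" and sf: "socially_fair D A I 2 q \<C>" for q \<C>
  proof -
    (* Any point of a cluster would do for a common location; its least index names one. *)
    define site where "site C = location I (Min C)" for C
    have site: "site {1, 2} = a" "site {3, 4} = b"
      by (simp_all add: site_def I_def two_site_data_def)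
    have site_center: "\<forall>C\<in>{{1, 2}, {3, 4}}. site C \<in> A I C"
      using A[of I "{1, 2}"] A[of I "{3, 4}"] by (auto simp: site_def)
    have site_location: "location I i = site C" if "C \<in> {{1, 2}, {3, 4}}" "i \<in> C" for C i
      using that site by (auto simp: I_def two_site_data_def)
    obtain c where c: "\<And>g C i. g \<in> groups I \<Longrightarrow> C \<in> \<C> \<Longrightarrow> i \<in> members I g \<Longrightarrow> i \<in> C \<Longrightarrow>
        location I i = c C"
      using socially_fair_imp_at_center[where D = D and A = A, OF valid D
          clustering_by_site[of a b, folded I_def] site_center site_location \<C> q sf] by blast
    obtain C where C: "C \<in> \<C>"
      using \<C> by (fastforce simp: clusterings_def)
    have "C \<inter> members I g \<noteq> {}" if "g \<in> groups I" for g
      using mr_fair_imp_meets_all[OF \<C> p[unfolded p_def] mr[unfolded p_def] that _ C] by simp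
    then obtain i j where ij: "i \<in> C" "i \<in> members I 0" "j \<in> C" "j \<in> members I 1"
      using g by blast
    then have "location I i = location I j"
      using c[OF g(1) C] c[OF g(2) C] by simp
    moreover have "location I i = a" "location I j = b"
      using ij by (auto simp: I_def two_site_data_def)
    ultimately show False using ab by simp
  qed
  then have "fair_clusterings mr_fair I 2 p \<inter> fair_clusterings (socially_fair D A) I 2 q = {}"
    if "q \<in> sf_params I" for q
    using that by (auto simp: fair_clusterings_def)
  moreover have "2 \<le> num_points I" by (simp add: I_def two_site_data_def)
  ultimately show ?thesis
    unfolding incompatible_def using valid p
    by (intro exI[of _ I] exI[of _ 2]) auto
qed

theorem proposition2:
  "incompatible mr_params mr_fair sf_params
     (socially_fair (kmeans_cost :: real ^ 'm::finite \<Rightarrow> real ^ 'm \<Rightarrow> real) kmeans_centers) \<and>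
   (\<forall>D :: real ^ 'm \<Rightarrow> real ^ 'm \<Rightarrow> real. Metric_space UNIV D \<longrightarrow>
      incompatible mr_params mr_fair sf_params (socially_fair D kmedians_centers))"
proof (intro conjI allI impI)
  have ne: "(0 :: real ^ 'm) \<noteq> 1" by (simp add: vec_eq_iff)
  show "incompatible mr_params mr_fair sf_params
      (socially_fair (kmeans_cost :: real ^ 'm \<Rightarrow> real ^ 'm \<Rightarrow> real) kmeans_centers)"
    by (rule mr_fair_incompatible_socially_fair[OF _ _ _ ne])
      (auto simp: kmeans_cost_def kmeans_centers_def)
  fix D :: "real ^ 'm \<Rightarrow> real ^ 'm \<Rightarrow> real"
  assume "Metric_space UNIV D"
  then interpret Metric_space UNIV D .
  show "incompatible mr_params mr_fair sf_params (socially_fair D kmedians_centers)"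
    by (rule mr_fair_incompatible_socially_fair[OF _ _ _ ne])
      (auto simp: kmedians_centers_def)
qed

end
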